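(* There exists a c.e. set $A \subseteq \omega$ of density $1$ which has no computable subset of density $1$.
   Context: $\omega = \{0,1,2,\dots\}$; c.e. means computably enumerable. The density of $S \subseteq \omega$ is $\rho(S) = \lim_{n\to\infty} \frac{|S \cap [0,n]|}{n+1}$, when this limit exists. *)

theory Defs
  imports Complex_Main
begin

text \<open>
  Computability is given by Kleene's partial recursive functions. Terms carry no arity: a term
  denotes a partial function of each arity, the arity being the length of the argument list, and
  it is undefined on argument lists whose length does not fit (e.g. \<open>Succ\<close> on two arguments).
\<close>

datatype recf =
    Zero
  | Succ
  | Proj nat
  | Comp recf "recf list"
  | PrimRec recf recf
  | Mu recf

text \<open>
  \<open>evaluates p xs y\<close>: the computation of \<open>p\<close> on the arguments \<open>xs\<close> halts with output \<open>y\<close>.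
  The recursion argument and the minimisation variable come first in the argument list.
  In \<open>Mu\<close>, as usual, the values at all arguments below the least zero have to be defined.
\<close>

inductive evaluates :: "recf \<Rightarrow> nat list \<Rightarrow> nat \<Rightarrow> bool" where
  Zero: "evaluates Zero xs 0"
| Succ: "evaluates Succ [x] (Suc x)"
| Proj: "i < length xs \<Longrightarrow> evaluates (Proj i) xs (xs ! i)"
| Comp: "list_all2 (\<lambda>g y. evaluates g xs y) gs ys \<Longrightarrow> evaluates f ys z
    \<Longrightarrow> evaluates (Comp f gs) xs z"
| PrimRec_0: "evaluates f xs y \<Longrightarrow> evaluates (PrimRec f g) (0 # xs) y"
| PrimRec_Suc: "evaluates (PrimRec f g) (n # xs) r \<Longrightarrow> evaluates g (n # r # xs) y
    \<Longrightarrow> evaluates (PrimRec f g) (Suc n # xs) y"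
| Mu: "\<forall>m<n. \<exists>y. evaluates f (m # xs) (Suc y) \<Longrightarrow> evaluates f (n # xs) 0
    \<Longrightarrow> evaluates (Mu f) xs n"

inductive_cases evaluates_ZeroE: "evaluates Zero xs y"
inductive_cases evaluates_SuccE: "evaluates Succ xs y"
inductive_cases evaluates_ProjE: "evaluates (Proj i) xs y"
inductive_cases evaluates_CompE: "evaluates (Comp f gs) xs y"
inductive_cases evaluates_PrimRec_0E: "evaluates (PrimRec f g) (0 # xs) y"
inductive_cases evaluates_PrimRec_SucE: "evaluates (PrimRec f g) (Suc n # xs) y"
inductive_cases evaluates_MuE: "evaluates (Mu f) xs y"

lemma evaluates_deterministic:
  "evaluates p xs y \<Longrightarrow> evaluates p xs z \<Longrightarrow> y = z"
proof (induction arbitrary: z rule: evaluates.induct)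
  case (Zero xs)
  then show ?case by (rule evaluates_ZeroE) simp
next
  case (Succ x)
  then show ?case by (rule evaluates_SuccE) simp
next
  case (Proj i xs)
  from Proj.prems show ?case by (rule evaluates_ProjE) simp
next
  case (Comp xs gs ys f w)
  from Comp.prems obtain ys' where
    ys': "list_all2 (\<lambda>g y. evaluates g xs y) gs ys'" and w: "evaluates f ys' z"
    by (blast elim: evaluates_CompE)
  have "ys = ys'"
  proof (rule nth_equalityI)
    show "length ys = length ys'"
      using list_all2_lengthD[OF Comp.IH(1)] list_all2_lengthD[OF ys'] by simp
    show "ys ! i = ys' ! i" if "i < length ys" for i
    proof -
      have "i < length gs"
        using list_all2_lengthD[OF Comp.IH(1)] that by simp
      with list_all2_nthD[OF Comp.IH(1) this] list_all2_nthD[OF ys' this]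
      show ?thesis by blast
    qed
  qed
  with w Comp.IH(2) show ?case by blast
next
  case (PrimRec_0 f xs y g)
  from PrimRec_0.prems show ?case
    by (rule evaluates_PrimRec_0E) (rule PrimRec_0.IH)
next
  case (PrimRec_Suc f g n xs r y)
  from PrimRec_Suc.prems obtain r' where
    r': "evaluates (PrimRec f g) (n # xs) r'" and z: "evaluates g (n # r' # xs) z"
    by (blast elim: evaluates_PrimRec_SucE)
  from PrimRec_Suc.IH(1)[OF r'] z have "evaluates g (n # r # xs) z"
    by simp
  then show ?case by (rule PrimRec_Suc.IH(2))
next
  case (Mu n f xs)
  have below: "\<forall>m<z. \<exists>y. evaluates f (m # xs) (Suc y)"
    using Mu.prems by (rule evaluates_MuE)
  have zero: "evaluates f (z # xs) 0"
    using Mu.prems by (rule evaluates_MuE)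
  show ?case
  proof (rule linorder_cases[of n z])
    assume "n < z"
    with below obtain y where "evaluates f (n # xs) (Suc y)"
      by blast
    then have "0 = Suc y" by (rule Mu.IH(2))
    then show ?thesis by simp
  next
    assume "z < n"
    with Mu.IH(1) obtain y where "\<forall>w. evaluates f (z # xs) w \<longrightarrow> Suc y = w"
      by blast
    with zero have "Suc y = 0" by blast
    then show ?thesis by simp
  qed simp
qed

definition computable_set :: "nat set \<Rightarrow> bool" where
  "computable_set A \<longleftrightarrow> (\<exists>p. \<forall>n. evaluates p [n] (if n \<in> A then 1 else 0))"

definition ce_set :: "nat set \<Rightarrow> bool" where
  "ce_set A \<longleftrightarrow> (\<exists>p. A = {n. \<exists>y. evaluates p [n] y})"

definition has_density :: "nat set \<Rightarrow> real \<Rightarrow> bool" where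
  "has_density S d \<longleftrightarrow> (\<lambda>n. real (card (S \<inter> {0..n})) / real (n + 1)) \<longlonglongrightarrow> d"

end

theory Submission
  imports Defs "HOL-Library.Nat_Bijection"
begin

text \<open>
  Split the positive integers into the dyadic classes \<open>R e = {2 ^ e * (2 * q + 1) | q}\<close>, each of
  positive density. If a set contains all but finitely many elements of each class, then it has
  density 1: up to a finite set it contains every non-multiple of \<open>2 ^ E\<close>, for each \<open>E\<close>. Class \<open>e\<close> is
  used to defeat the program with code \<open>e\<close>. At every stage one block \<open>R e \<inter> {c..2 * c}\<close> of the class
  is held, and the other elements seen so far enter the set \<open>A\<close> (\<open>diagonal_set\<close>). When the program has
  been seen to answer 0 (not in the set) on the whole held block, the block is released into \<open>A\<close> and
  a new one, beyond all numbers considered so far, is held instead.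

  At most one block of each class is held forever, so \<open>A\<close> has density 1. Suppose the program decides
  a subset \<open>B\<close> of \<open>A\<close>. A block that is held forever would be disjoint from \<open>A\<close>, hence from \<open>B\<close>, so
  the program would eventually answer 0 on all of it and the block would be released. Therefore
  infinitely many blocks get released (\<open>held_unbounded\<close>), and \<open>B\<close> misses each of them entirely
  (\<open>misses_blocks\<close>). For large \<open>c\<close> the block makes up a fraction of \<open>{0..2 * c}\<close> that is bounded away from 0,
  so \<open>B\<close> does not have density 1.

  The construction has to run all programs simultaneously. This is done by an abstract machine whose
  states are numbers and whose step function is recursive. Only one direction of its correctness is
  proved: if a program has a value, the machine reaches it (\<open>machine_complete\<close>). Since the machine is
  deterministic and the program that is to be defeated is total, that direction determines all of
  the machine's answers. On partial programs any behaviour of the machine is harmless, because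
  \<open>A\<close> is c.e. and has density 1 whatever the machine answers.
\<close>

section \<open>Total recursive functions\<close>

text \<open>
  A total function is represented by its value on an environment \<open>xs\<close> of \<open>k\<close> variables. All closure
  properties are stated for functions \<open>\<lambda>xs. t\<close>, so that recursiveness of a composite expression is
  proved by backward chaining along its syntax (\<open>recursive_intros\<close>). Bound variables are added at
  the front of the environment, and the outer variables are then found in its tail.
\<close>

definition recursive :: "nat \<Rightarrow> (nat list \<Rightarrow> nat) \<Rightarrow> bool" where
  "recursive k f \<longleftrightarrow> (\<exists>p. \<forall>xs. length xs = k \<longrightarrow> evaluates p xs (f xs))"

abbreviation decidable :: "nat \<Rightarrow> (nat list \<Rightarrow> bool) \<Rightarrow> bool" where
  "decidable k P \<equiv> recursive k (\<lambda>xs. of_bool (P xs))"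

named_theorems recursive_intros

lemma recursive_cong:
  assumes "recursive k f" and "\<And>xs. length xs = k \<Longrightarrow> f xs = g xs"
  shows "recursive k g"
  using assms unfolding recursive_def by metis

lemma recursive_compose:
  assumes f: "recursive (length gs) f" and gs: "\<forall>g\<in>set gs. recursive k g"
  shows "recursive k (\<lambda>xs. f (map (\<lambda>g. g xs) gs))"
proof -
  obtain p where p: "\<And>ys. length ys = length gs \<Longrightarrow> evaluates p ys (f ys)"
    using f unfolding recursive_def by blast
  obtain Q where Q: "\<forall>g\<in>set gs. \<forall>xs. length xs = k \<longrightarrow> evaluates (Q g) xs (g xs)"
    using bchoice[OF gs[unfolded recursive_def]] by blast
  have "evaluates (Comp p (map Q gs)) xs (f (map (\<lambda>g. g xs) gs))" if "length xs = k" for xs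
  proof (rule evaluates.Comp)
    show "list_all2 (\<lambda>g y. evaluates g xs y) (map Q gs) (map (\<lambda>g. g xs) gs)"
      using Q that by (auto simp: list_all2_conv_all_nth)
  qed (use p in simp)
  then show ?thesis unfolding recursive_def by blast
qed

lemma recursive_nth [recursive_intros]: "i < k \<Longrightarrow> recursive k (\<lambda>xs. xs ! i)"
  unfolding recursive_def by (metis evaluates.Proj)

lemma recursive_Suc [recursive_intros]:
  assumes "recursive k a"
  shows "recursive k (\<lambda>xs. Suc (a xs))"
proof -
  have "recursive (length [a]) (\<lambda>ys. Suc (ys ! 0))"
    unfolding recursive_def
    by (rule exI[of _ Succ]) (auto simp: length_Suc_conv intro: evaluates.Succ)
  from recursive_compose[OF this, of k] assms show ?thesis by simp
qed

lemma recursive_const [recursive_intros]: "recursive k (\<lambda>xs. c)"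
proof (induction c)
  case 0
  show ?case unfolding recursive_def by (blast intro: evaluates.Zero)
qed (rule recursive_Suc)

lemma recursive_rearrange:
  assumes f: "recursive (length is) f" and "\<forall>i\<in>set is. i < k"
  shows "recursive k (\<lambda>xs. f (map (\<lambda>i. xs ! i) is))"
proof -
  have "recursive k (\<lambda>xs. f (map (\<lambda>g. g xs) (map (\<lambda>i xs. xs ! i) is)))"
    using assms by (intro recursive_compose) (auto intro: recursive_nth)
  then show ?thesis by (simp add: comp_def)
qed

lemma recursive_tl:
  assumes "recursive k a"
  shows "recursive (Suc k) (\<lambda>ys. a (tl ys))"
proof -
  have "recursive (Suc k) (\<lambda>ys. a (map (\<lambda>i. ys ! i) [1..<Suc k]))"
    using assms by (intro recursive_rearrange) (auto simp del: upt_Suc)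
  moreover have "map (\<lambda>i. ys ! i) [1..<Suc k] = tl ys" if "length ys = Suc k" for ys :: "nat list"
    by (rule nth_equalityI) (use that in \<open>auto simp: nth_tl simp del: upt_Suc\<close>)
  ultimately show ?thesis by (auto elim: recursive_cong)
qed

text \<open>
  An outer variable, as seen from under one binder.
\<close>

lemma recursive_nth_tl [recursive_intros]: "Suc i < k \<Longrightarrow> recursive k (\<lambda>xs. tl xs ! i)"
  using recursive_tl[OF recursive_nth, of i "k - 1"] by (cases k) auto

lemma recursive_rec_nat [recursive_intros]:
  assumes a: "recursive k a" and b: "recursive k b"
    and F: "recursive (Suc (Suc k)) (\<lambda>ys. F (tl (tl ys)) (ys ! 0) (ys ! 1))"
  shows "recursive k (\<lambda>xs. rec_nat (b xs) (F xs) (a xs))"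
proof -
  obtain p where p: "\<And>xs. length xs = k \<Longrightarrow> evaluates p xs (b xs)"
    using b unfolding recursive_def by blast
  obtain q where q: "\<And>ys. length ys = Suc (Suc k) \<Longrightarrow>
      evaluates q ys (F (tl (tl ys)) (ys ! 0) (ys ! 1))"
    using F unfolding recursive_def by blast
  have rec: "evaluates (PrimRec p q) (n # xs) (rec_nat (b xs) (F xs) n)"
    if "length xs = k" for n xs
  proof (induction n)
    case 0
    then show ?case using p[OF that] by (simp add: evaluates.PrimRec_0)
  next
    case (Suc n)
    have "evaluates q (n # rec_nat (b xs) (F xs) n # xs) (F xs n (rec_nat (b xs) (F xs) n))"
      using q[of "n # rec_nat (b xs) (F xs) n # xs"] that by simp
    with Suc show ?case by (simp add: evaluates.PrimRec_Suc)
  qed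
  let ?gs = "a # map (\<lambda>i xs. xs ! i) [0..<k]"
  have "recursive (length ?gs) (\<lambda>ys. rec_nat (b (tl ys)) (F (tl ys)) (hd ys))"
    unfolding recursive_def by (rule exI[of _ "PrimRec p q"]) (auto simp: length_Suc_conv rec)
  moreover have "\<forall>g\<in>set ?gs. recursive k g"
    using a by (auto intro: recursive_nth)
  ultimately
  have "recursive k (\<lambda>xs. (\<lambda>ys. rec_nat (b (tl ys)) (F (tl ys)) (hd ys)) (map (\<lambda>g. g xs) ?gs))"
    by (rule recursive_compose)
  then show ?thesis
  proof (rule recursive_cong)
    fix xs :: "nat list" assume "length xs = k"
    then have "map (\<lambda>g. g xs) ?gs = a xs # xs"
      by (auto simp: comp_def intro: map_nth)
    then show "(\<lambda>ys. rec_nat (b (tl ys)) (F (tl ys)) (hd ys)) (map (\<lambda>g. g xs) ?gs) =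
        rec_nat (b xs) (F xs) (a xs)" by simp
  qed
qed

lemma recursive_add [recursive_intros]:
  assumes "recursive k a" "recursive k b"
  shows "recursive k (\<lambda>xs. a xs + b xs)"
proof -
  have "m + n = rec_nat m (\<lambda>_ r. Suc r) n" for m n by (induction n) auto
  then show ?thesis by (simp only:) (intro recursive_intros assms; simp)
qed

lemma recursive_mult [recursive_intros]:
  assumes "recursive k a" "recursive k b"
  shows "recursive k (\<lambda>xs. a xs * b xs)"
proof -
  have "m * n = rec_nat 0 (\<lambda>_ r. r + m) n" for m n by (induction n) auto
  then show ?thesis
    by (simp only:) (intro recursive_intros assms recursive_tl[OF recursive_tl]; simp)
qed

lemma recursive_diff [recursive_intros]:
  assumes "recursive k a" "recursive k b"
  shows "recursive k (\<lambda>xs. a xs - b xs)"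
proof -
  have "m - n = rec_nat m (\<lambda>_ r. rec_nat 0 (\<lambda>i _. i) r) n" for m n
  proof (induction n)
    case (Suc n)
    have "x - 1 = rec_nat 0 (\<lambda>i _. i) x" for x :: nat by (cases x) auto
    with Suc show ?case by (metis diff_Suc_eq_diff_pred diff_commute old.nat.simps(7))
  qed auto
  then show ?thesis by (simp only:) (intro recursive_intros assms; simp)
qed

lemma recursive_power [recursive_intros]:
  assumes "recursive k a" "recursive k b"
  shows "recursive k (\<lambda>xs. a xs ^ b xs)"
proof -
  have "m ^ n = rec_nat 1 (\<lambda>_ r. r * m) n" for m n :: nat by (induction n) auto
  then show ?thesis
    by (simp only:) (intro recursive_intros assms recursive_tl[OF recursive_tl]; simp)
qed

lemma decidable_le [recursive_intros]:
  assumes "recursive k a" "recursive k b"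
  shows "decidable k (\<lambda>xs. a xs \<le> b xs)"
proof -
  have "of_bool (m \<le> n) = 1 - (m - n)" for m n :: nat by (cases "m \<le> n") auto
  then show ?thesis by (simp only:) (intro recursive_intros assms)
qed

lemma decidable_not [recursive_intros]:
  assumes "decidable k P"
  shows "decidable k (\<lambda>xs. \<not> P xs)"
proof -
  have "of_bool (\<not> b) = 1 - (of_bool b :: nat)" for b by simp
  then show ?thesis by (simp only:) (intro recursive_intros assms)
qed

lemma decidable_conj [recursive_intros]:
  assumes "decidable k P" "decidable k Q"
  shows "decidable k (\<lambda>xs. P xs \<and> Q xs)"
  unfolding of_bool_conj by (intro recursive_intros assms)

lemma decidable_imp [recursive_intros]:
  assumes "decidable k P" "decidable k Q"
  shows "decidable k (\<lambda>xs. P xs \<longrightarrow> Q xs)"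
proof -
  have "(b \<longrightarrow> c) = (\<not> (b \<and> \<not> c))" for b c by blast
  then show ?thesis by (simp only:) (intro recursive_intros assms)
qed

lemma decidable_eq [recursive_intros]:
  assumes "recursive k a" "recursive k b"
  shows "decidable k (\<lambda>xs. a xs = b xs)"
  unfolding eq_iff by (intro recursive_intros assms)

lemma recursive_if [recursive_intros]:
  assumes "decidable k P" "recursive k a" "recursive k b"
  shows "recursive k (\<lambda>xs. if P xs then a xs else b xs)"
proof -
  have "(if c then m else n) = of_bool c * m + of_bool (\<not> c) * n" for c and m n :: nat by simp
  then show ?thesis by (simp only:) (intro recursive_intros assms)
qed

lemma decidable_bex [recursive_intros]:
  assumes a: "recursive k a" and P: "decidable (Suc k) (\<lambda>ys. P (tl ys) (ys ! 0))"
  shows "decidable k (\<lambda>xs. \<exists>i\<le>a xs. P xs i)"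
proof -
  have *: "of_bool (\<exists>i\<le>n. Q i) = rec_nat 0 (\<lambda>i r. if Q i then 1 else r) (Suc n)"
    for Q and n :: nat
  proof -
    have "of_bool (\<exists>i<n. Q i) = rec_nat 0 (\<lambda>i r. if Q i then 1 else r) n" for n
    proof (induction n)
      case (Suc n)
      have "(\<exists>i<Suc n. Q i) \<longleftrightarrow> Q n \<or> (\<exists>i<n. Q i)" by (auto simp: less_Suc_eq)
      with Suc show ?case by simp
    qed simp
    from this[of "Suc n"] show ?thesis by (simp only: less_Suc_eq_le)
  qed
  have "decidable (Suc (Suc k)) (\<lambda>ys. P (tl (map (\<lambda>i. ys ! i) (0 # [2..<Suc (Suc k)])))
      (map (\<lambda>i. ys ! i) (0 # [2..<Suc (Suc k)]) ! 0))"
    using P by (intro recursive_rearrange) (auto simp del: upt_Suc)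
  then have "decidable (Suc (Suc k)) (\<lambda>ys. P (tl (tl ys)) (ys ! 0))"
  proof (rule recursive_cong)
    fix ys :: "nat list" assume "length ys = Suc (Suc k)"
    then have "map (\<lambda>i. ys ! i) [2..<Suc (Suc k)] = tl (tl ys)"
      by (intro nth_equalityI) (auto simp: nth_tl simp del: upt_Suc)
    then show "of_bool (P (tl (map (\<lambda>i. ys ! i) (0 # [2..<Suc (Suc k)])))
        (map (\<lambda>i. ys ! i) (0 # [2..<Suc (Suc k)]) ! 0)) =
      (of_bool (P (tl (tl ys)) (ys ! 0)) :: nat)" by simp
  qed
  then show ?thesis unfolding * by (intro recursive_intros a; simp)
qed

lemma decidable_ball [recursive_intros]:
  assumes a: "recursive k a" and P: "decidable (Suc k) (\<lambda>ys. P (tl ys) (ys ! 0))"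
  shows "decidable k (\<lambda>xs. \<forall>i\<le>a xs. P xs i)"
proof -
  have "(\<forall>i\<le>n. Q i) = (\<not> (\<exists>i\<le>n. \<not> Q i))" for Q and n :: nat by blast
  then show ?thesis by (simp only:) (intro recursive_intros assms)
qed

text \<open>
  Only a totally defined minimisation stays inside the total functions, hence the second assumption.
\<close>

lemma recursive_Least:
  assumes F: "decidable (Suc k) (\<lambda>ys. P (tl ys) (ys ! 0))" and ex: "\<And>xs. \<exists>n. P xs n"
  shows "recursive k (\<lambda>xs. LEAST n. P xs n)"
proof -
  have "decidable (Suc k) (\<lambda>ys. \<not> P (tl ys) (ys ! 0))" by (intro recursive_intros F)
  then obtain p where p: "\<And>ys. length ys = Suc k \<Longrightarrow>
      evaluates p ys (of_bool (\<not> P (tl ys) (ys ! 0)))"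
    unfolding recursive_def by blast
  have "evaluates (Mu p) xs (LEAST n. P xs n)" if "length xs = k" for xs
  proof (rule evaluates.Mu)
    show "\<forall>m<LEAST n. P xs n. \<exists>y. evaluates p (m # xs) (Suc y)"
    proof (intro allI impI)
      fix m assume "m < (LEAST n. P xs n)"
      then have "\<not> P xs m" by (rule not_less_Least)
      with p[of "m # xs"] that show "\<exists>y. evaluates p (m # xs) (Suc y)" by auto
    qed
    have "P xs (LEAST n. P xs n)" using ex by (rule LeastI_ex)
    then show "evaluates p ((LEAST n. P xs n) # xs) 0"
      using p[of "(LEAST n. P xs n) # xs"] that by simp
  qed
  then show ?thesis unfolding recursive_def by blast
qed

text \<open>
  The search for a witness, \<open>Mu\<close>, halts exactly on the projection.
\<close>

lemma ce_set_projection: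
  assumes "decidable 2 (\<lambda>xs. P (xs ! 1) (xs ! 0))"
  shows "ce_set {m. \<exists>s. P m s}"
proof -
  have "decidable 2 (\<lambda>xs. \<not> P (xs ! 1) (xs ! 0))" by (intro recursive_intros assms)
  then obtain p where "\<And>ys. length ys = 2 \<Longrightarrow> evaluates p ys (of_bool (\<not> P (ys ! 1) (ys ! 0)))"
    unfolding recursive_def by blast
  from this[of "[s, m]" for s m]
  have p: "evaluates p [s, m] (of_bool (\<not> P m s))" for s m by simp
  have "(\<exists>s. P m s) \<longleftrightarrow> (\<exists>y. evaluates (Mu p) [m] y)" for m
  proof
    assume "\<exists>s. P m s"
    then have "P m (LEAST s. P m s)" by (rule LeastI_ex)
    moreover have "\<exists>y. evaluates p [s, m] (Suc y)" if "s < (LEAST s. P m s)" for s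
      using not_less_Least[OF that] p[of s m] by auto
    ultimately have "evaluates (Mu p) [m] (LEAST s. P m s)"
      using p[of "LEAST s. P m s" m] by (auto intro: evaluates.Mu)
    then show "\<exists>y. evaluates (Mu p) [m] y" by blast
  next
    assume "\<exists>y. evaluates (Mu p) [m] y"
    then obtain s where "evaluates p [s, m] 0" by (blast elim: evaluates_MuE)
    with evaluates_deterministic[OF p] have "of_bool (\<not> P m s) = (0 :: nat)" by blast
    then show "\<exists>s. P m s" by auto
  qed
  then show ?thesis unfolding ce_set_def by blast
qed

section \<open>Pairs\<close>

abbreviation pair :: "nat \<Rightarrow> nat \<Rightarrow> nat" where
  "pair m n \<equiv> prod_encode (m, n)"

definition pfst :: "nat \<Rightarrow> nat" where "pfst n = fst (prod_decode n)"
definition psnd :: "nat \<Rightarrow> nat" where "psnd n = snd (prod_decode n)"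

lemma pfst_pair [simp]: "pfst (pair m n) = m" and psnd_pair [simp]: "psnd (pair m n) = n"
  by (simp_all add: pfst_def psnd_def)

lemma recursive_triangle [recursive_intros]:
  assumes "recursive k a"
  shows "recursive k (\<lambda>xs. triangle (a xs))"
proof -
  have "triangle n = rec_nat 0 (\<lambda>i r. r + Suc i) n" for n by (induction n) auto
  then show ?thesis by (simp only:) (intro recursive_intros assms; simp)
qed

lemma recursive_pair [recursive_intros]:
  assumes "recursive k a" "recursive k b"
  shows "recursive k (\<lambda>xs. pair (a xs) (b xs))"
  unfolding prod_encode_def case_prod_conv by (intro recursive_intros assms)

lemma triangle_mono: "m \<le> n \<Longrightarrow> triangle m \<le> triangle n"
  by (induction n) (auto simp: le_Suc_eq)

text \<open>
  The Cantor pairing enumerates the pairs by antidiagonals \<open>m + n = d\<close>, and the antidiagonal \<open>d\<close> starts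
  at \<open>triangle d\<close>. Once \<open>d\<close> is found by search, both projections are obtained by subtraction.
\<close>

definition diagonal :: "nat \<Rightarrow> nat" where
  "diagonal n = (LEAST d. n < triangle (Suc d))"

lemma diagonal_pair: "diagonal (pair m n) = m + n"
  unfolding diagonal_def
proof (rule Least_equality)
  show "pair m n < triangle (Suc (m + n))" by (simp add: prod_encode_def)
  fix d assume d: "pair m n < triangle (Suc d)"
  show "m + n \<le> d"
  proof (rule ccontr)
    assume "\<not> m + n \<le> d"
    then have "triangle (Suc d) \<le> triangle (m + n)" by (intro triangle_mono) simp
    with d show False by (simp add: prod_encode_def)
  qed
qed

lemma recursive_diagonal [recursive_intros]:
  assumes "recursive k a"
  shows "recursive k (\<lambda>xs. diagonal (a xs))"
  unfolding diagonal_def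
proof (rule recursive_Least)
  show "decidable (Suc k) (\<lambda>ys. a (tl ys) < triangle (Suc (ys ! 0)))"
    unfolding less_eq_Suc_le by (intro recursive_intros recursive_tl[OF assms]; simp)
  have "n \<le> triangle n" for n by (induction n) auto
  then have "a xs < triangle (Suc (a xs))" for xs
    by (meson Suc_le_lessD)
  then show "\<exists>n. a xs < triangle (Suc n)" for xs by blast
qed

lemma recursive_pfst [recursive_intros]:
  assumes "recursive k a"
  shows "recursive k (\<lambda>xs. pfst (a xs))"
proof -
  have "pfst n = n - triangle (diagonal n)" for n
  proof -
    obtain u v where "n = pair u v" by (metis prod_decode_inverse surj_pair)
    then show ?thesis by (simp add: diagonal_pair) (simp add: prod_encode_def)
  qed
  then show ?thesis by (simp only:) (intro recursive_intros assms)
qed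

lemma recursive_psnd [recursive_intros]:
  assumes "recursive k a"
  shows "recursive k (\<lambda>xs. psnd (a xs))"
proof -
  have "psnd n = diagonal n - pfst n" for n
  proof -
    obtain u v where "n = pair u v" by (metis prod_decode_inverse surj_pair)
    then show ?thesis by (simp add: diagonal_pair)
  qed
  then show ?thesis by (simp only:) (intro recursive_intros assms)
qed

section \<open>An abstract machine for recursive functions\<close>

text \<open>
  Lists are coded by \<open>list_encode\<close>; \<open>pcons\<close>, \<open>phd\<close> and \<open>ptl\<close> are its constructor and destructors.
\<close>

definition pcons :: "nat \<Rightarrow> nat \<Rightarrow> nat" where "pcons x l = Suc (pair x l)"
definition phd :: "nat \<Rightarrow> nat" where "phd l = pfst (l - 1)"
definition ptl :: "nat \<Rightarrow> nat" where "ptl l = psnd (l - 1)"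

lemma phd_pcons [simp]: "phd (pcons x l) = x" and ptl_pcons [simp]: "ptl (pcons x l) = l"
  and pcons_neq_0 [simp]: "pcons x l \<noteq> 0"
  by (simp_all add: phd_def ptl_def pcons_def)

lemma list_encode_Cons: "list_encode (x # xs) = pcons x (list_encode xs)"
  by (simp add: pcons_def)

text \<open>
  The states of the machine. \<open>Eval p xs K\<close> is about to run \<open>p\<close> on \<open>xs\<close> and to pass the result to the
  continuation \<open>K\<close>; \<open>Return y K\<close> passes \<open>y\<close> to \<open>K\<close>; \<open>Args f gs ys xs K\<close> is in the middle of a composition:
  the programs \<open>gs\<close> have still to be run on \<open>xs\<close>, the values \<open>ys\<close> are already known, and \<open>f\<close> is
  to be applied at the end.
\<close>

definition Eval :: "nat \<Rightarrow> nat \<Rightarrow> nat \<Rightarrow> nat" where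
  "Eval p xs K = pair 0 (pair p (pair xs K))"
definition Return :: "nat \<Rightarrow> nat \<Rightarrow> nat" where
  "Return y K = pair 1 (pair y K)"
definition Args :: "nat \<Rightarrow> nat \<Rightarrow> nat \<Rightarrow> nat \<Rightarrow> nat \<Rightarrow> nat" where
  "Args f gs ys xs K = pair 2 (pair f (pair gs (pair ys (pair xs K))))"

text \<open>
  The continuations: one for each construct that waits for the value of a subprogram. The tag 0 is left
  for the empty continuation, which is the number 0.
\<close>

definition ArgK :: "nat \<Rightarrow> nat \<Rightarrow> nat \<Rightarrow> nat \<Rightarrow> nat \<Rightarrow> nat" where
  "ArgK f gs ys xs K = pair 1 (pair f (pair gs (pair ys (pair xs K))))"
definition RecK :: "nat \<Rightarrow> nat \<Rightarrow> nat \<Rightarrow> nat" where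
  "RecK g xs K = pair 2 (pair g (pair xs K))"
definition MuK :: "nat \<Rightarrow> nat \<Rightarrow> nat \<Rightarrow> nat" where
  "MuK f xs K = pair 3 (pair f (pair xs K))"

text \<open>
  The argument programs of a composition are stored in reverse. They are run from last to first, so that
  consing each new value in front of the earlier ones yields the argument list in the right order.
\<close>

fun code :: "recf \<Rightarrow> nat" where
  "code Zero = pair 0 0"
| "code Succ = pair 1 0"
| "code (Proj i) = pair 2 i"
| "code (Comp f gs) = pair 3 (pair (code f) (list_encode (rev (map code gs))))"
| "code (PrimRec f g) = pair 4 (pair (code f) (code g))"
| "code (Mu f) = pair 5 (code f)"

text \<open>
  A projection is executed by walking down the argument list, one element per step. A primitive
  recursion on \<open>Suc n\<close> first runs itself on \<open>n\<close>.
\<close>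

definition step_eval :: "nat \<Rightarrow> nat \<Rightarrow> nat \<Rightarrow> nat" where
  "step_eval p xs K =
    (if pfst p = 0 then Return 0 K
     else if pfst p = 1 then Return (Suc (phd xs)) K
     else if pfst p = 2 then
       (if psnd p = 0 then Return (phd xs) K else Eval (pair 2 (psnd p - 1)) (ptl xs) K)
     else if pfst p = 3 then Args (pfst (psnd p)) (psnd (psnd p)) 0 xs K
     else if pfst p = 4 then
       (if phd xs = 0 then Eval (pfst (psnd p)) (ptl xs) K
        else Eval p (pcons (phd xs - 1) (ptl xs))
          (RecK (psnd (psnd p)) (pcons (phd xs - 1) (ptl xs)) K))
     else Eval (psnd p) (pcons 0 xs) (MuK (psnd p) (pcons 0 xs) K))"

definition step_args :: "nat \<Rightarrow> nat \<Rightarrow> nat \<Rightarrow> nat \<Rightarrow> nat \<Rightarrow> nat" where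
  "step_args f gs ys xs K =
    (if gs = 0 then Eval f ys K else Eval (phd gs) xs (ArgK f (ptl gs) ys xs K))"

definition resume_args :: "nat \<Rightarrow> nat \<Rightarrow> nat" where
  "resume_args y d = Args (pfst d) (pfst (psnd d)) (pcons y (pfst (psnd (psnd d))))
     (pfst (psnd (psnd (psnd d)))) (psnd (psnd (psnd (psnd d))))"

definition resume_rec :: "nat \<Rightarrow> nat \<Rightarrow> nat \<Rightarrow> nat \<Rightarrow> nat" where
  "resume_rec y g xs K = Eval g (pcons (phd xs) (pcons y (ptl xs))) K"

definition resume_mu :: "nat \<Rightarrow> nat \<Rightarrow> nat \<Rightarrow> nat \<Rightarrow> nat" where
  "resume_mu y f xs K =
    (if y = 0 then Return (phd xs) K
     else Eval f (pcons (Suc (phd xs)) (ptl xs)) (MuK f (pcons (Suc (phd xs)) (ptl xs)) K))"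

definition step_return :: "nat \<Rightarrow> nat \<Rightarrow> nat" where
  "step_return y K =
    (if pfst K = 0 then Return y K
     else if pfst K = 1 then resume_args y (psnd K)
     else if pfst K = 2 then
       resume_rec y (pfst (psnd K)) (pfst (psnd (psnd K))) (psnd (psnd (psnd K)))
     else resume_mu y (pfst (psnd K)) (pfst (psnd (psnd K))) (psnd (psnd (psnd K))))"

definition step :: "nat \<Rightarrow> nat" where
  "step s = (if pfst s = 0 then
       step_eval (pfst (psnd s)) (pfst (psnd (psnd s))) (psnd (psnd (psnd s)))
     else if pfst s = 1 then step_return (pfst (psnd s)) (psnd (psnd s))
     else step_args (pfst (psnd s)) (pfst (psnd (psnd s))) (pfst (psnd (psnd (psnd s))))
       (pfst (psnd (psnd (psnd (psnd s))))) (psnd (psnd (psnd (psnd (psnd s))))))"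

lemma step_simps:
  "step (Eval p xs K) = step_eval p xs K"
  "step (Return y K) = step_return y K"
  "step (Args f gs ys xs K) = step_args f gs ys xs K"
  by (simp_all add: step_def Eval_def Return_def Args_def)

lemma step_return_simps:
  "step_return y (ArgK f gs ys xs K) = Args f gs (pcons y ys) xs K"
  "step_return y (RecK g xs K) = resume_rec y g xs K"
  "step_return y (MuK f xs K) = resume_mu y f xs K"
  by (simp_all add: step_return_def resume_args_def ArgK_def RecK_def MuK_def)

lemma pfst_0: "pfst 0 = 0"
  using pfst_pair[of 0 0] by (simp add: prod_encode_def)

text \<open>
  The final states are fixed points, so an answer, once given, is given at all later times.
\<close>

lemma step_halted: "step (Return y 0) = Return y 0"
  by (simp add: step_simps step_return_def pfst_0)

definition reaches :: "nat \<Rightarrow> nat \<Rightarrow> bool" where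
  "reaches s s' \<longleftrightarrow> (\<exists>t. (step ^^ t) s = s')"

lemma reaches_refl: "reaches s s"
  unfolding reaches_def by (rule exI[of _ 0]) simp

lemma reaches_step: "reaches (step s) s' \<Longrightarrow> reaches s s'"
  unfolding reaches_def by (metis funpow_Suc_right comp_apply)

lemma reaches_trans [trans]: "reaches s s' \<Longrightarrow> reaches s' s'' \<Longrightarrow> reaches s s''"
  unfolding reaches_def by (metis funpow_add comp_apply)

text \<open>
  The values of the pending programs are put in front of the values \<open>ys'\<close> that are already known.
\<close>

lemma reaches_Args:
  assumes "list_all2 (\<lambda>g y. \<forall>K. reaches (Eval (code g) xs K) (Return y K)) gs ys"
  shows "reaches (Args f (list_encode (rev (map code gs))) (list_encode ys') xs K)
    (Eval f (list_encode (ys @ ys')) K)"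
  using assms
proof (induction gs arbitrary: ys ys' rule: rev_induct)
  case Nil
  then show ?case
    by - (rule reaches_step, simp add: step_simps step_args_def reaches_refl)
next
  case (snoc g gs)
  from snoc.prems obtain zs y where ys: "ys = zs @ [y]"
    and zs: "list_all2 (\<lambda>g y. \<forall>K. reaches (Eval (code g) xs K) (Return y K)) gs zs"
    and y: "\<And>K. reaches (Eval (code g) xs K) (Return y K)"
    by (auto simp: list_all2_append1 list_all2_Cons1)
  let ?K = "ArgK f (list_encode (rev (map code gs))) (list_encode ys') xs K"
  have "reaches (Args f (list_encode (rev (map code (gs @ [g])))) (list_encode ys') xs K)
      (Eval (code g) xs ?K)"
    by (rule reaches_step)
      (simp add: step_simps step_args_def list_encode_Cons reaches_refl del: list_encode.simps(2))
  also note y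
  also have "reaches (Return y ?K)
      (Args f (list_encode (rev (map code gs))) (list_encode (y # ys')) xs K)"
    by (rule reaches_step)
      (simp add: step_simps step_return_simps list_encode_Cons reaches_refl
        del: list_encode.simps(2))
  also note snoc.IH[OF zs]
  finally show ?case by (simp add: ys)
qed

text \<open>
  The statement is for every continuation \<open>K\<close>, since the induction hypotheses are applied to subprograms,
  and most of these run under a longer continuation than the whole program.
\<close>

lemma machine_complete:
  "evaluates p xs y \<Longrightarrow> reaches (Eval (code p) (list_encode xs) K) (Return y K)"
proof (induction arbitrary: K rule: evaluates.induct)
  case (Zero xs)
  show ?case by (rule reaches_step) (simp add: step_simps step_eval_def reaches_refl)
next
  case (Succ x)
  show ?case
    by (rule reaches_step)
      (simp add: step_simps step_eval_def list_encode_Cons reaches_refl del: list_encode.simps(2))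
next
  case (Proj i xs)
  then show ?case
  proof (induction i arbitrary: xs)
    case 0
    then obtain x xs' where "xs = x # xs'" by (cases xs) auto
    then show ?case
      by - (rule reaches_step,
        simp add: step_simps step_eval_def list_encode_Cons reaches_refl del: list_encode.simps(2))
  next
    case (Suc i)
    then obtain x xs' where xs: "xs = x # xs'" by (cases xs) auto
    then have "step (Eval (code (Proj (Suc i))) (list_encode xs) K) =
        Eval (code (Proj i)) (list_encode xs') K"
      by (simp add: step_simps step_eval_def list_encode_Cons del: list_encode.simps(2))
    with Suc.IH[of xs'] Suc.prems xs show ?case
      by - (rule reaches_step, simp del: code.simps)
  qed
next
  case (Comp xs gs ys f z)
  have "reaches (Eval (code (Comp f gs)) (list_encode xs) K)
      (Args (code f) (list_encode (rev (map code gs))) (list_encode []) (list_encode xs) K)"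
    by (rule reaches_step) (simp add: step_simps step_eval_def reaches_refl)
  also have "reaches \<dots> (Eval (code f) (list_encode (ys @ [])) K)"
    by (rule reaches_Args) (use Comp.IH(1) in \<open>auto elim: list_all2_mono\<close>)
  also have "reaches \<dots> (Return z K)"
    using Comp.IH(2) by simp
  finally show ?case .
next
  case (PrimRec_0 f xs y g)
  show ?case
    by (rule reaches_step)
      (use PrimRec_0.IH in \<open>simp add: step_simps step_eval_def list_encode_Cons
        del: list_encode.simps(2)\<close>)
next
  case (PrimRec_Suc f g n xs r y)
  let ?K = "RecK (code g) (list_encode (n # xs)) K"
  have "reaches (Eval (code (PrimRec f g)) (list_encode (Suc n # xs)) K)
      (Eval (code (PrimRec f g)) (list_encode (n # xs)) ?K)"
    by (rule reaches_step)
      (simp add: step_simps step_eval_def list_encode_Cons reaches_refl del: list_encode.simps(2))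
  also note PrimRec_Suc.IH(1)
  also have "reaches (Return r ?K) (Eval (code g) (list_encode (n # r # xs)) K)"
    by (rule reaches_step)
      (simp add: step_simps step_return_simps resume_rec_def list_encode_Cons reaches_refl
        del: list_encode.simps(2))
  also note PrimRec_Suc.IH(2)
  finally show ?case .
next
  case (Mu n f xs)
  let ?K = "\<lambda>m. MuK (code f) (list_encode (m # xs)) K"
  have loop: "reaches (Eval (code (Mu f)) (list_encode xs) K)
      (Eval (code f) (list_encode (m # xs)) (?K m))" if "m \<le> n" for m
    using that
  proof (induction m)
    case 0
    show ?case
      by (rule reaches_step)
        (simp add: step_simps step_eval_def list_encode_Cons reaches_refl del: list_encode.simps(2))
  next
    case (Suc m)
    then obtain y where y: "\<And>K. reaches (Eval (code f) (list_encode (m # xs)) K) (Return (Suc y) K)"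
      using Mu.IH(1) by (meson Suc_le_lessD)
    have "reaches (Eval (code (Mu f)) (list_encode xs) K)
        (Eval (code f) (list_encode (m # xs)) (?K m))"
      using Suc by simp
    also note y
    also have "reaches (Return (Suc y) (?K m)) (Eval (code f) (list_encode (Suc m # xs)) (?K (Suc m)))"
      by (rule reaches_step)
        (simp add: step_simps step_return_simps resume_mu_def list_encode_Cons reaches_refl
          del: list_encode.simps(2))
    finally show ?case .
  qed
  have "reaches (Eval (code (Mu f)) (list_encode xs) K)
      (Eval (code f) (list_encode (n # xs)) (?K n))"
    using loop by simp
  also note Mu.IH(2)
  also have "reaches (Return 0 (?K n)) (Return n K)"
    by (rule reaches_step)
      (simp add: step_simps step_return_simps resume_mu_def list_encode_Cons reaches_refl
        del: list_encode.simps(2))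
  finally show ?case .
qed

lemma recursive_pcons [recursive_intros]:
    "recursive k a \<Longrightarrow> recursive k b \<Longrightarrow> recursive k (\<lambda>xs. pcons (a xs) (b xs))"
  and recursive_phd [recursive_intros]:
    "recursive k a \<Longrightarrow> recursive k (\<lambda>xs. phd (a xs))"
  and recursive_ptl [recursive_intros]:
    "recursive k a \<Longrightarrow> recursive k (\<lambda>xs. ptl (a xs))"
  unfolding pcons_def phd_def ptl_def by (intro recursive_intros; assumption)+

lemma recursive_Eval [recursive_intros]:
    "recursive k a \<Longrightarrow> recursive k b \<Longrightarrow> recursive k c \<Longrightarrow>
      recursive k (\<lambda>xs. Eval (a xs) (b xs) (c xs))"
  and recursive_Return [recursive_intros]:
    "recursive k a \<Longrightarrow> recursive k b \<Longrightarrow> recursive k (\<lambda>xs. Return (a xs) (b xs))"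
  and recursive_Args [recursive_intros]:
    "recursive k a \<Longrightarrow> recursive k b \<Longrightarrow> recursive k c \<Longrightarrow> recursive k d \<Longrightarrow> recursive k e \<Longrightarrow>
      recursive k (\<lambda>xs. Args (a xs) (b xs) (c xs) (d xs) (e xs))"
  and recursive_ArgK [recursive_intros]:
    "recursive k a \<Longrightarrow> recursive k b \<Longrightarrow> recursive k c \<Longrightarrow> recursive k d \<Longrightarrow> recursive k e \<Longrightarrow>
      recursive k (\<lambda>xs. ArgK (a xs) (b xs) (c xs) (d xs) (e xs))"
  and recursive_RecK [recursive_intros]:
    "recursive k a \<Longrightarrow> recursive k b \<Longrightarrow> recursive k c \<Longrightarrow>
      recursive k (\<lambda>xs. RecK (a xs) (b xs) (c xs))"
  and recursive_MuK [recursive_intros]: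
    "recursive k a \<Longrightarrow> recursive k b \<Longrightarrow> recursive k c \<Longrightarrow>
      recursive k (\<lambda>xs. MuK (a xs) (b xs) (c xs))"
  unfolding Eval_def Return_def Args_def ArgK_def RecK_def MuK_def
  by (intro recursive_intros; assumption)+

lemma recursive_step_eval [recursive_intros]:
  assumes "recursive k a" "recursive k b" "recursive k c"
  shows "recursive k (\<lambda>xs. step_eval (a xs) (b xs) (c xs))"
  unfolding step_eval_def by (intro recursive_intros assms)

lemma recursive_step_args [recursive_intros]:
  assumes "recursive k a" "recursive k b" "recursive k c" "recursive k d" "recursive k e"
  shows "recursive k (\<lambda>xs. step_args (a xs) (b xs) (c xs) (d xs) (e xs))"
  unfolding step_args_def by (intro recursive_intros assms)

lemma recursive_resume_args [recursive_intros]: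
  assumes "recursive k a" "recursive k b"
  shows "recursive k (\<lambda>xs. resume_args (a xs) (b xs))"
  unfolding resume_args_def by (intro recursive_intros assms)

lemma recursive_resume_rec [recursive_intros]:
  assumes "recursive k a" "recursive k b" "recursive k c" "recursive k d"
  shows "recursive k (\<lambda>xs. resume_rec (a xs) (b xs) (c xs) (d xs))"
  unfolding resume_rec_def by (intro recursive_intros assms)

lemma recursive_resume_mu [recursive_intros]:
  assumes "recursive k a" "recursive k b" "recursive k c" "recursive k d"
  shows "recursive k (\<lambda>xs. resume_mu (a xs) (b xs) (c xs) (d xs))"
  unfolding resume_mu_def by (intro recursive_intros assms)

lemma recursive_step_return [recursive_intros]:
  assumes "recursive k a" "recursive k b"
  shows "recursive k (\<lambda>xs. step_return (a xs) (b xs))"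
  unfolding step_return_def by (intro recursive_intros assms)

lemma recursive_step [recursive_intros]:
  assumes "recursive k a"
  shows "recursive k (\<lambda>xs. step (a xs))"
  unfolding step_def by (intro recursive_intros assms)

text \<open>
  The machine, run for \<open>t\<close> steps on the program with code \<open>e\<close> and the argument list \<open>[x]\<close>, has
  halted with output 0. For a number \<open>e\<close> that codes no program this is still a decidable relation.
\<close>

definition rejects :: "nat \<Rightarrow> nat \<Rightarrow> nat \<Rightarrow> bool" where
  "rejects e x t \<longleftrightarrow> (step ^^ t) (Eval e (pcons x 0) 0) = Return 0 0"

lemma decidable_rejects [recursive_intros]:
  assumes "recursive k a" "recursive k b" "recursive k c"
  shows "decidable k (\<lambda>xs. rejects (a xs) (b xs) (c xs))"
proof -
  have "(step ^^ t) s = rec_nat s (\<lambda>_ r. step r) t" for s t by (induction t) auto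
  then show ?thesis unfolding rejects_def Eval_def Return_def
    by (simp only:) (intro recursive_intros assms; simp)
qed

lemma halted_mono:
  assumes "(step ^^ t) s = Return y 0" and "t \<le> u"
  shows "(step ^^ u) s = Return y 0"
  using assms(2)
proof (induction u rule: dec_induct)
  case base
  show ?case by (rule assms)
qed (simp add: step_halted)

lemma rejects_mono: "rejects e x t \<Longrightarrow> t \<le> u \<Longrightarrow> rejects e x u"
  unfolding rejects_def by (rule halted_mono)

lemma Return_inject: "Return y 0 = Return z 0 \<Longrightarrow> y = z"
  unfolding Return_def by (metis pfst_pair psnd_pair)

text \<open>
  Completeness of the machine is enough: it reaches the correct answer, and as its final states are
  fixed points it cannot reach another one.
\<close>

lemma rejects_code_iff:
  assumes p: "\<And>n. evaluates p [n] (if n \<in> B then 1 else 0)"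
  shows "(\<exists>t. rejects (code p) x t) \<longleftrightarrow> x \<notin> B"
proof -
  let ?s = "Eval (code p) (pcons x 0) 0" and ?b = "if x \<in> B then 1 else 0 :: nat"
  have "reaches ?s (Return ?b 0)"
    using machine_complete[OF p[of x], of 0] by (simp add: pcons_def)
  then obtain u where u: "(step ^^ u) ?s = Return ?b 0"
    unfolding reaches_def by blast
  have "?b = 0" if "rejects (code p) x t" for t
  proof (rule Return_inject)
    have "(step ^^ max t u) ?s = Return ?b 0" using u by (rule halted_mono) simp
    moreover have "(step ^^ max t u) ?s = Return 0 0"
      using that unfolding rejects_def by (rule halted_mono) simp
    ultimately show "Return ?b 0 = Return 0 0" by simp
  qed
  with u show ?thesis unfolding rejects_def by (cases "x \<in> B") auto
qed

section \<open>Dyadic classes\<close>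

definition dyadic_class :: "nat \<Rightarrow> nat set" where
  "dyadic_class e = {x. \<exists>q. x = 2 ^ e * (2 * q + 1)}"

lemma decidable_dyadic_class [recursive_intros]:
  assumes "recursive k a" "recursive k b"
  shows "decidable k (\<lambda>xs. a xs \<in> dyadic_class (b xs))"
proof -
  have "x \<in> dyadic_class e \<longleftrightarrow> (\<exists>q\<le>x. x = 2 ^ e * (2 * q + 1))" for x e
  proof -
    have "q \<le> 2 ^ e * (2 * q + 1)" for q :: nat
    proof -
      have "1 * q \<le> 2 ^ e * (2 * q + 1)" by (intro mult_le_mono) auto
      then show ?thesis by simp
    qed
    then show ?thesis unfolding dyadic_class_def by auto
  qed
  then show ?thesis
    by (simp only:) (intro recursive_intros recursive_tl assms; simp)
qed

lemma dyadic_class_unique: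
  assumes "x \<in> dyadic_class d" "x \<in> dyadic_class e"
  shows "d = e"
proof -
  have False if less: "d < e" and xd: "x \<in> dyadic_class d" and xe: "x \<in> dyadic_class e" for d e
  proof -
    from xd xe obtain q r where "2 ^ d * (2 * q + 1) = (2 :: nat) ^ e * (2 * r + 1)"
      unfolding dyadic_class_def by auto
    moreover have "(2 :: nat) ^ e = 2 ^ d * (2 * 2 ^ (e - Suc d))"
      using less by (metis Suc_leI le_add_diff_inverse power_add power_Suc2 mult.assoc)
    ultimately have "2 ^ d * (2 * q + 1) = (2 :: nat) ^ d * (2 * (2 ^ (e - Suc d) * (2 * r + 1)))"
      by (simp only: mult.assoc)
    then have "2 * q + 1 = 2 * (2 ^ (e - Suc d) * (2 * r + 1))"
      by (simp only: mult_cancel1) simp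
    then show False by presburger
  qed
  with assms show ?thesis by (meson linorder_neqE_nat)
qed

text \<open>
  A number that is divisible by \<open>2 ^ E\<close> but not by \<open>2 ^ Suc E\<close> lies in the class \<open>E\<close>.
\<close>

lemma dyadic_class_exhaust: "2 ^ E dvd x \<or> (\<exists>e<E. x \<in> dyadic_class e)"
proof (induction E)
  case (Suc E)
  show ?case
  proof (cases "\<exists>e<E. x \<in> dyadic_class e")
    case False
    with Suc obtain y where y: "x = 2 ^ E * y" by (auto elim: dvdE)
    show ?thesis
    proof (cases "even y")
      case True
      with y show ?thesis by (auto elim!: evenE)
    next
      case False
      with y have "x \<in> dyadic_class E" unfolding dyadic_class_def by (auto elim!: oddE)
      then show ?thesis by blast
    qed
  qed (auto simp: less_Suc_eq)
qed simp

text \<open>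
  Each interval of length \<open>2 ^ Suc e\<close> that starts at a multiple of its length contains one element of the
  class, and those with index from \<open>c div 2 ^ Suc e + 1\<close> up to \<open>2 * c div 2 ^ Suc e - 1\<close> lie
  inside \<open>{c..2 * c}\<close>.
\<close>

lemma card_dyadic_class_ge:
  "2 * c div 2 ^ Suc e \<le> card (dyadic_class e \<inter> {c..2 * c}) + c div 2 ^ Suc e + 1"
proof -
  let ?M = "2 ^ Suc e :: nat" and ?f = "\<lambda>q. 2 ^ e * (2 * q + 1) :: nat"
  have "?f ` {c div ?M + 1..<2 * c div ?M} \<subseteq> dyadic_class e \<inter> {c..2 * c}"
  proof (rule image_subsetI)
    fix q assume q: "q \<in> {c div ?M + 1..<2 * c div ?M}"
    have "c < ?M * (c div ?M + 1)" by (simp add: dividend_less_times_div)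
    also have "\<dots> \<le> ?M * q" using q by (intro mult_le_mono2) simp
    finally have 1: "c \<le> ?f q" by (simp add: algebra_simps)
    have "?M * Suc q \<le> ?M * (2 * c div ?M)" using q by (intro mult_le_mono2) simp
    also have "\<dots> \<le> 2 * c" by (rule times_div_less_eq_dividend)
    finally have 2: "?f q \<le> 2 * c" by (simp add: algebra_simps)
    from 1 2 show "?f q \<in> dyadic_class e \<inter> {c..2 * c}" by (auto simp: dyadic_class_def)
  qed
  then have "card (?f ` {c div ?M + 1..<2 * c div ?M}) \<le> card (dyadic_class e \<inter> {c..2 * c})"
    by (intro card_mono) auto
  moreover have "card (?f ` {c div ?M + 1..<2 * c div ?M}) = 2 * c div ?M - (c div ?M + 1)"
    by (subst card_image) (auto simp: inj_on_def)
  ultimately show ?thesis by linarith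
qed

section \<open>The construction\<close>

definition block :: "nat \<Rightarrow> nat \<Rightarrow> nat set" where
  "block e c = dyadic_class e \<inter> {c..2 * c}"

text \<open>
  By time \<open>s\<close> the program has been seen to reject the whole block; by \<open>cleared_iff\<close> this is a
  quantifier over \<open>block e c\<close>. It is written with a numerical bound so that it is visibly decidable.
\<close>

definition cleared :: "nat \<Rightarrow> nat \<Rightarrow> nat \<Rightarrow> bool" where
  "cleared e c s \<longleftrightarrow> (\<forall>x\<le>2 * c. c \<le> x \<and> x \<in> dyadic_class e \<longrightarrow> rejects e x s)"

lemma cleared_iff: "cleared e c s \<longleftrightarrow> (\<forall>x\<in>block e c. rejects e x s)"
  by (auto simp: cleared_def block_def)

text \<open>
  The left end point of the block of class \<open>e\<close> that is held at stage \<open>s\<close>. A released block is replaced by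
  the one starting at the current stage.
\<close>

primrec held :: "nat \<Rightarrow> nat \<Rightarrow> nat" where
  "held e 0 = 0"
| "held e (Suc s) = (if cleared e (held e s) s then Suc s else held e s)"

text \<open>
  The stage \<open>s\<close> counts for \<open>m\<close> only if \<open>m \<le> s\<close>, since \<open>m\<close> may belong to a block that is held later, and
  such a block starts after the current stage. The bound on \<open>e\<close> makes the matrix decidable; every
  class that contains \<open>m\<close> satisfies it.
\<close>

definition diagonal_set :: "nat set" where
  "diagonal_set = {m. \<exists>s. m \<le> s \<and> (\<exists>e\<le>m. m \<in> dyadic_class e \<and> m \<notin> {held e s..2 * held e s})}"

lemma recursive_held [recursive_intros]:
  assumes "recursive k a" "recursive k b"
  shows "recursive k (\<lambda>xs. held (a xs) (b xs))"
proof -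
  have "held e s = rec_nat 0 (\<lambda>s c. if cleared e c s then Suc s else c) s" for e s
    by (induction s) auto
  then show ?thesis unfolding cleared_def
    by (simp only:)
      (intro recursive_intros assms recursive_tl[OF recursive_tl[OF recursive_tl[OF assms(1)]]]; simp)
qed

lemma ce_set_diagonal_set: "ce_set diagonal_set"
  unfolding diagonal_set_def atLeastAtMost_iff
  by (rule ce_set_projection) (intro recursive_intros; simp)

lemma mem_diagonal_set_iff:
  "m \<in> diagonal_set \<longleftrightarrow> (\<exists>e s. m \<in> dyadic_class e \<and> m \<le> s \<and> m \<notin> {held e s..2 * held e s})"
proof -
  have "e \<le> m" if m: "m \<in> dyadic_class e" for e
  proof -
    obtain q where "m = 2 ^ e * (2 * q + 1)" using m by (auto simp: dyadic_class_def)
    then have "2 ^ e \<le> m" by simp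
    moreover have "e < 2 ^ e" by (rule less_exp)
    ultimately show ?thesis by linarith
  qed
  then show ?thesis unfolding diagonal_set_def by blast
qed

lemma held_le: "held e s \<le> s"
  by (induction s) auto

lemma held_mono: "s \<le> t \<Longrightarrow> held e s \<le> held e t"
proof (induction t rule: dec_induct)
  case (step t)
  then show ?case using held_le[of e t] by auto
qed simp

text \<open>
  A block that is ever held becomes held at the stage equal to its left end point.
\<close>

lemma held_held: "held e (held e s) = held e s"
  by (induction s) auto

text \<open>
  If the held blocks are bounded by \<open>N\<close>, then nothing above \<open>2 * N\<close> is ever held; otherwise every
  element of the class is eventually passed by the held block.
\<close>

lemma finite_class_minus_diagonal_set: "finite (dyadic_class e - diagonal_set)"
proof (cases "\<exists>N. \<forall>s. held e s \<le> N")
  case True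
  then obtain N where N: "\<And>s. held e s \<le> N" by blast
  have "m \<in> diagonal_set" if "m \<in> dyadic_class e" "2 * N < m" for m
    unfolding mem_diagonal_set_iff using that N[of m] by (intro exI[of _ e] exI[of _ m]) auto
  then have "dyadic_class e - diagonal_set \<subseteq> {..2 * N}" by (auto simp: not_less[symmetric])
  then show ?thesis by (rule finite_subset) simp
next
  case False
  have "m \<in> diagonal_set" if "m \<in> dyadic_class e" for m
  proof -
    obtain s where "m < held e s" using False by (meson not_le)
    then show ?thesis
      unfolding mem_diagonal_set_iff using that held_le[of e s] by (intro exI[of _ e] exI[of _ s]) auto
  qed
  then have "dyadic_class e - diagonal_set = {}" by blast
  then show ?thesis by (simp only: finite.emptyI)
qed

text \<open>
  The held block moves on only after it has been cleared.
\<close>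

lemma held_passes:
  assumes "s \<le> t" and "held e s < held e t"
  shows "\<exists>u. cleared e (held e s) u"
proof -
  have "held e t = held e s \<or> (\<exists>u. cleared e (held e s) u)"
    using \<open>s \<le> t\<close>
  proof (induction t rule: dec_induct)
    case (step t)
    then show ?case by (auto split: if_splits)
  qed simp
  with assms show ?thesis by simp
qed

text \<open>
  If the held blocks were bounded, the largest of them, starting at \<open>c\<close>, would be held at every
  stage from \<open>c\<close> on. Its elements would not enter the set, so none of them would be in \<open>B\<close>; but then the
  program rejects each of them, the block is cleared at some stage, and a larger one is held.
\<close>

lemma held_unbounded:
  assumes p: "\<And>n. evaluates p [n] (if n \<in> B then 1 else 0)" and "B \<subseteq> diagonal_set"
  shows "\<exists>s. N < held (code p) s"
proof (rule ccontr)
  let ?e = "code p"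
  assume "\<nexists>s. N < held ?e s"
  then have "finite (range (held ?e))" by (auto simp: not_less intro: finite_subset[of _ "{..N}"])
  define c where "c = Max (range (held ?e))"
  have c_max: "held ?e s \<le> c" for s
    unfolding c_def using \<open>finite _\<close> by simp
  have "c \<in> range (held ?e)"
    unfolding c_def using \<open>finite _\<close> by (intro Max_in) auto
  then have "held ?e c = c" using held_held by auto
  then have held_c: "held ?e s = c" if "c \<le> s" for s
    using held_mono[OF that, of ?e] c_max[of s] by simp
  \<comment> \<open>A stage that counts for an element of the block is at least \<open>c\<close>, so the block is held then.\<close>
  have "\<exists>t. rejects ?e x t" if x: "x \<in> block ?e c" for x
  proof -
    have "x \<notin> diagonal_set"
    proof
      assume "x \<in> diagonal_set"
      then obtain d s where "x \<in> dyadic_class d" "x \<le> s" "x \<notin> {held d s..2 * held d s}"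
        unfolding mem_diagonal_set_iff by blast
      moreover from x \<open>x \<in> dyadic_class d\<close> have "d = ?e"
        unfolding block_def by (blast intro: dyadic_class_unique)
      moreover have "held ?e s = c" using x \<open>x \<le> s\<close> by (intro held_c) (simp add: block_def)
      ultimately show False using x by (simp add: block_def)
    qed
    with \<open>B \<subseteq> diagonal_set\<close> show ?thesis using rejects_code_iff[OF p] by blast
  qed
  then obtain t where t: "\<And>x. x \<in> block ?e c \<Longrightarrow> rejects ?e x (t x)" by metis
  have "finite (block ?e c)" by (simp add: block_def)
  \<comment> \<open>The stage has to be at least \<open>c\<close> for the block to be the held one.\<close>
  define u where "u = Max (insert c (t ` block ?e c))"
  have "t x \<le> u" if "x \<in> block ?e c" for x
    unfolding u_def using \<open>finite (block _ _)\<close> that by simp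
  then have "cleared ?e c u"
    unfolding cleared_iff using t rejects_mono by blast
  moreover have "c \<le> u" unfolding u_def using \<open>finite (block _ _)\<close> by simp
  ultimately have "held ?e (Suc u) = Suc u" using held_c by simp
  with c_max[of "Suc u"] \<open>c \<le> u\<close> show False by simp
qed

lemma misses_blocks:
  assumes p: "\<And>n. evaluates p [n] (if n \<in> B then 1 else 0)" and "B \<subseteq> diagonal_set"
  shows "\<exists>c>N. B \<inter> block (code p) c = {}"
proof -
  obtain s where s: "N < held (code p) s" using held_unbounded[OF assms] by blast
  obtain t where t: "held (code p) s < held (code p) t" using held_unbounded[OF assms] by blast
  then have "s \<le> t" using held_mono[of t s "code p"] by linarith
  with held_passes t obtain u where "cleared (code p) (held (code p) s) u" by blast
  then have "B \<inter> block (code p) (held (code p) s) = {}"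
    unfolding cleared_iff using rejects_code_iff[OF p] by blast
  with s show ?thesis by blast
qed

section \<open>Densities\<close>

text \<open>
  The multiples of \<open>2 ^ E\<close> have density \<open>1 / 2 ^ E\<close> and finite sets have density 0, so the complement of
  \<open>S\<close> has upper density at most \<open>1 / 2 ^ E\<close>, for every \<open>E\<close>.
\<close>

lemma has_density_1_if_complement_in_multiples:
  assumes "\<And>E. \<exists>F. finite F \<and> (\<forall>x. x \<in> S \<or> x \<in> F \<or> 2 ^ E dvd x)"
  shows "has_density S 1"
  unfolding has_density_def
proof (rule LIMSEQ_I)
  fix r :: real assume "0 < r"
  obtain E where E: "(1 / 2) ^ E < r / 2"
    using real_arch_pow_inv[of "r / 2" "1 / 2"] \<open>0 < r\<close> by auto
  obtain F where F: "finite F" "\<And>x. x \<in> S \<or> x \<in> F \<or> 2 ^ E dvd x" using assms[of E] by blast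
  \<comment> \<open>Half of the error \<open>r\<close> is for the multiples of \<open>2 ^ E\<close>; the other half is for \<open>F\<close> and for the
    multiple 0.\<close>
  obtain n0 :: nat where n0: "(card F + 1) / (r / 2) < n0" using reals_Archimedean2 by blast
  have "norm (real (card (S \<inter> {0..n})) / real (n + 1) - 1) < r" if "n0 \<le> n" for n
  proof -
    let ?M = "2 ^ E :: nat"
    have "{0..n} \<subseteq> (S \<inter> {0..n}) \<union> F \<union> (\<lambda>k. ?M * k) ` {0..n div ?M}"
    proof
      fix x assume x: "x \<in> {0..n}"
      show "x \<in> (S \<inter> {0..n}) \<union> F \<union> (\<lambda>k. ?M * k) ` {0..n div ?M}"
      proof (cases "x \<in> S \<or> x \<in> F")
        case False
        then obtain k where k: "x = ?M * k" using F(2)[of x] by (auto elim: dvdE)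
        then have "k \<in> {0..n div ?M}" using x by (simp add: less_eq_div_iff_mult_less_eq mult.commute)
        with k show ?thesis by blast
      qed (use x in auto)
    qed
    then have "card {0..n} \<le> card ((S \<inter> {0..n}) \<union> F \<union> (\<lambda>k. ?M * k) ` {0..n div ?M})"
      using F(1) by (intro card_mono) auto
    also have "\<dots> \<le> card (S \<inter> {0..n}) + card F + card ((\<lambda>k. ?M * k) ` {0..n div ?M})"
      by (meson add_mono card_Un_le le_trans order_refl)
    also have "card ((\<lambda>k. ?M * k) ` {0..n div ?M}) \<le> n div ?M + 1"
      using card_image_le[of "{0..n div ?M}" "\<lambda>k. ?M * k"] by simp
    finally have "real (n + 1) \<le> real (card (S \<inter> {0..n}) + card F + (n div ?M + 1))"
      by (simp only: of_nat_le_iff) simp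
    moreover have "real (n div ?M) \<le> real (n + 1) * (r / 2)"
    proof -
      have "real (n div ?M) \<le> real n / real ?M" by (rule of_nat_div_le_of_nat)
      also have "\<dots> = real n * (1 / 2) ^ E" by (simp add: power_divide)
      also have "\<dots> \<le> real (n + 1) * (r / 2)" using E by (intro mult_mono) auto
      finally show ?thesis .
    qed
    moreover have "real (card F + 1) < real (n + 1) * (r / 2)"
    proof -
      have "real (card F + 1) < real n0 * (r / 2)" using n0 \<open>0 < r\<close> by (simp add: field_simps)
      also have "\<dots> \<le> real (n + 1) * (r / 2)" using that \<open>0 < r\<close> by (intro mult_mono) auto
      finally show ?thesis .
    qed
    ultimately have "real (n + 1) * (1 - r) < real (card (S \<inter> {0..n}))"
      by (simp add: algebra_simps)
    then have "1 - r < real (card (S \<inter> {0..n})) / real (n + 1)"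
      by (simp add: field_simps)
    moreover have "real (card (S \<inter> {0..n})) / real (n + 1) \<le> 1"
      using card_mono[of "{0..n}" "S \<inter> {0..n}"] by simp
    ultimately show ?thesis by simp
  qed
  then show "\<exists>n0. \<forall>n\<ge>n0. norm (real (card (S \<inter> {0..n})) / real (n + 1) - 1) < r" by blast
qed

lemma has_density_diagonal_set: "has_density diagonal_set 1"
proof (rule has_density_1_if_complement_in_multiples)
  fix E
  have "finite (\<Union>e<E. dyadic_class e - diagonal_set)" using finite_class_minus_diagonal_set by blast
  moreover have "x \<in> diagonal_set \<or> x \<in> (\<Union>e<E. dyadic_class e - diagonal_set) \<or> 2 ^ E dvd x" for x
    using dyadic_class_exhaust[of E x] by blast
  ultimately show "\<exists>F. finite F \<and> (\<forall>x. x \<in> diagonal_set \<or> x \<in> F \<or> 2 ^ E dvd x)" by blast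
qed

text \<open>
  With \<open>M = 2 ^ Suc e\<close>, the block at \<open>c\<close> has at least \<open>c / M - 2\<close> elements. For \<open>c > 8 * M\<close> this is at least
  the fraction \<open>1 / (4 * M)\<close> of \<open>{0..2 * c}\<close>, so the proportion of \<open>B\<close> in \<open>{0..2 * c}\<close> is at most
  \<open>1 - 1 / (4 * M)\<close> for arbitrarily large \<open>c\<close>.
\<close>

lemma not_has_density_1_if_misses_blocks:
  assumes "\<And>N. \<exists>c>N. B \<inter> block e c = {}"
  shows "\<not> has_density B 1"
proof
  define M :: nat where "M = 2 ^ Suc e"
  have "0 < M" by (simp add: M_def)
  assume "has_density B 1"
  moreover have "0 < 1 / (4 * real M)" using \<open>0 < M\<close> by simp
  ultimately obtain n0 where n0: "\<And>n. n0 \<le> n \<Longrightarrow>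
      norm (real (card (B \<inter> {0..n})) / real (n + 1) - 1) < 1 / (4 * real M)"
    unfolding has_density_def using LIMSEQ_D by blast
  obtain c where c: "n0 + 8 * M < c" "B \<inter> block e c = {}" using assms by blast
  have "card (B \<inter> {0..2 * c}) + card (block e c) = card (B \<inter> {0..2 * c} \<union> block e c)"
    using c(2) by (subst card_Un_disjoint) (auto simp: block_def)
  also have "\<dots> \<le> card {0..2 * c}" by (intro card_mono) (auto simp: block_def)
  finally have "card (B \<inter> {0..2 * c}) + card (block e c) \<le> 2 * c + 1" by simp
  with card_dyadic_class_ge[of c e, folded M_def]
  have "card (B \<inter> {0..2 * c}) + 2 * c div M \<le> 2 * c + 1 + c div M + 1"
    unfolding block_def by linarith
  then have "real (card (B \<inter> {0..2 * c})) + real (2 * c div M) \<le>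
      real (2 * c + 1) + real (c div M) + 1"
    by linarith
  moreover have "real (c div M) \<le> real c / real M" by (rule of_nat_div_le_of_nat)
  moreover have "real (2 * c) / real M - 1 \<le> real (2 * c div M)"
    using floor_divide_of_nat_eq[of "2 * c" M, where 'a = real] by linarith
  moreover have "real (2 * c) / real M = 2 * (real c / real M)" using \<open>0 < M\<close> by simp
  ultimately have "real (card (B \<inter> {0..2 * c})) \<le> real (2 * c + 1) - (real c / real M - 2)"
    by linarith
  moreover have "real (2 * c + 1) * (1 / (4 * real M)) \<le> real c / real M - 2"
  proof -
    have "real (2 * c + 1) + 8 * real M \<le> 4 * real c"
      using c(1) \<open>0 < M\<close> by linarith
    then have "(real (2 * c + 1) + 8 * real M) / (4 * real M) \<le> 4 * real c / (4 * real M)"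
      by (rule divide_right_mono) simp
    then show ?thesis using \<open>0 < M\<close> by (simp add: add_divide_distrib)
  qed
  moreover have "a \<le> (1 - d) * t" if "a \<le> t - y" "t * d \<le> y" for a t y d :: real
    using that by (simp add: algebra_simps)
  ultimately have "real (card (B \<inter> {0..2 * c})) \<le> (1 - 1 / (4 * real M)) * real (2 * c + 1)"
    by blast
  then have "real (card (B \<inter> {0..2 * c})) / real (2 * c + 1) \<le> 1 - 1 / (4 * real M)"
    by (subst pos_divide_le_eq) simp_all
  moreover have "norm (real (card (B \<inter> {0..2 * c})) / real (2 * c + 1) - 1) < 1 / (4 * real M)"
    using c(1) by (intro n0) simp
  ultimately show False unfolding real_norm_def by linarith
qed

theorem theorem2p22:
  "\<exists>A :: nat set. ce_set A \<and> has_density A 1 \<and>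
     \<not> (\<exists>B. B \<subseteq> A \<and> computable_set B \<and> has_density B 1)"
proof (intro exI[of _ diagonal_set] conjI notI)
  show "ce_set diagonal_set" by (rule ce_set_diagonal_set)
  show "has_density diagonal_set 1" by (rule has_density_diagonal_set)
  assume "\<exists>B\<subseteq>diagonal_set. computable_set B \<and> has_density B 1"
  then obtain B p where "B \<subseteq> diagonal_set" "has_density B 1"
    and p: "\<And>n. evaluates p [n] (if n \<in> B then 1 else 0)"
    unfolding computable_set_def by blast
  have "\<not> has_density B 1"
    by (rule not_has_density_1_if_misses_blocks[OF misses_blocks[OF p \<open>B \<subseteq> diagonal_set\<close>]])
  with \<open>has_density B 1\<close> show False by contradiction
qed

end
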